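(* Let $\phi=(\sqrt5+1)/2$ be the golden ratio. There exists a potential function $\Phi$ on weight-biased leftist heaps such that, counting comparisons, the amortized costs of the operations satisfy: $\mathrm{empty}$, $\mathrm{isEmpty}(x)$, $\mathrm{single}(a)$ and $\mathrm{min}(x)$ have amortized cost $0$; $\mathrm{union}(x,y)$ has amortized cost at most $\log_\phi(|x|+|y|)$; and $\mathrm{delmin}(x)$ has amortized cost at most $\log_\phi |x|$.
   Context: Binary trees with labels from a totally ordered set $A$: $\langle\rangle$ is the empty tree and $\langle t,a,u\rangle$ is the tree with left subtree $t$, root label $a$, right subtree $u$; $\langle a\rangle$ abbreviates $\langle\langle\rangle,a,\langle\rangle\rangle$. The weight is $\#\langle\rangle=0$, $\#\langle t,a,u\rangle=\#t+\#u+1$, and $|x|=\#x+1$. A weight-biased leftist heap is such a tree in which every node's label is $\le$ all labels in its subtrees (heap property) and at every node $\langle t,a,u\rangle$ one has $\#t\ge\#u$. Operations: $\mathrm{empty}=\langle\rangle$; $\mathrm{isEmpty}(x)$ tests $x=\langle\rangle$; $\mathrm{single}(a)=\langle a\rangle$; $\mathrm{min}(\langle\rangle)=\infty$ (a value larger than all labels) and $\mathrm{min}(\langle t,a,u\rangle)=a$; $\mathrm{union}(x,y)=x\oplus y$; $\mathrm{delmin}(\langle t,a,u\rangle)=t\oplus u$. The meld $\oplus$ is defined by: $\langle\rangle\oplus\langle\rangle=\langle\rangle$; $\langle t,a,u\rangle\oplus y=\mathrm{bal}\langle t,a,u\oplus y\rangle$ if $a\le \mathrm{min}(y)$; and otherwise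 (i.e. $y=\langle t,a,u\rangle$ and the previous case does not apply) $x\oplus\langle t,a,u\rangle=\mathrm{bal}\langle t,a,x\oplus u\rangle$. Here $\mathrm{bal}\langle t,a,u\rangle=\langle t,a,u\rangle$ if $\#t>\#u$ and $\mathrm{bal}\langle t,a,u\rangle=\langle u,a,t\rangle$ if $\#t\le\#u$. Cost model: the actual cost counts the comparisons $a\le\mathrm{min}(y)$ made while unfolding $\oplus$ (including comparisons with $\infty$): $T_\oplus(\langle\rangle,\langle\rangle)=0$ and otherwise $T_\oplus(x,y)=1+T_\oplus$ of the single recursive call made. Thus $\mathrm{empty},\mathrm{isEmpty},\mathrm{single},\mathrm{min}$ have actual cost $0$, $\mathrm{union}(x,y)$ has actual cost $T_\oplus(x,y)$ and $\mathrm{delmin}(\langle t,a,u\rangle)$ has actual cost $T_\oplus(t,u)$. A potential function is a function $\Phi$ from heaps to the nonnegative reals with $\Phi(\langle\rangle)=0$; the amortized cost of an operation is its actual cost plus the potential of its result minus the potential of its heap arguments: e.g. amortized cost of $\mathrm{union}(x,y)$ is $T_\oplus(x,y)+\Phi(x\oplus y)-\Phi(x)-\Phi(y)$, of $\mathrm{delmin}(x)$ with $x=\langle t,a,u\rangle$ is $T_\oplus(t,u)+\Phi(t\oplus u)-\Phi(x)$, of $\mathrm{single}(a)$ is $0+\Phi(\langle a\rangle)$, and operations returning no heap or leaving heaps unchanged have amortized cost equal to their actual cost. *)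

theory Defs
  imports Complex_Main "HOL-Library.Tree" "HOL-Library.Extended"
begin

text \<open>
  The weights are those of the theory of trees: \<open>size\<close> for \<open>#\<close> and \<open>size1\<close> for
  \<open>|_|\<close>, see \<open>size1_size\<close>. The predicate \<open>heap\<close> of that theory is the heap property.
\<close>

fun weight_biased :: "'a tree \<Rightarrow> bool" where
  "weight_biased \<langle>\<rangle> \<longleftrightarrow> True"
| "weight_biased \<langle>t, a, u\<rangle> \<longleftrightarrow> size t \<ge> size u \<and> weight_biased t \<and> weight_biased u"

definition wbl_heap :: "'a::linorder tree \<Rightarrow> bool" where
  "wbl_heap x \<longleftrightarrow> heap x \<and> weight_biased x"

definition single :: "'a \<Rightarrow> 'a tree" where
  "single a = \<langle>\<langle>\<rangle>, a, \<langle>\<rangle>\<rangle>"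

fun heap_min :: "'a tree \<Rightarrow> 'a extended" where
  "heap_min \<langle>\<rangle> = \<infinity>"
| "heap_min \<langle>t, a, u\<rangle> = Fin a"

definition bal :: "'a tree \<Rightarrow> 'a \<Rightarrow> 'a tree \<Rightarrow> 'a tree" where
  "bal t a u = (if size t > size u then \<langle>t, a, u\<rangle> else \<langle>u, a, t\<rangle>)"

text \<open>
  In the third equation the premise says that the second one does not apply: it holds
  if \<open>x\<close> is empty or has a root label that is not \<open>\<le> a\<close>.
\<close>

function meld :: "'a::linorder tree \<Rightarrow> 'a tree \<Rightarrow> 'a tree" (infixl \<open>\<oplus>\<close> 65) where
  "\<langle>\<rangle> \<oplus> \<langle>\<rangle> = \<langle>\<rangle>"
| "Fin a \<le> heap_min y \<Longrightarrow> \<langle>t, a, u\<rangle> \<oplus> y = bal t a (u \<oplus> y)"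
| "\<not> heap_min x \<le> Fin a \<Longrightarrow> x \<oplus> \<langle>t, a, u\<rangle> = bal t a (x \<oplus> u)"
  apply (atomize_elim, clarify)
  subgoal for x y by (cases x; cases y) auto
  by auto
termination by (relation "measure (\<lambda>(x, y). size x + size y)") auto

function T_meld :: "'a::linorder tree \<Rightarrow> 'a tree \<Rightarrow> nat" where
  "T_meld \<langle>\<rangle> \<langle>\<rangle> = 0"
| "Fin a \<le> heap_min y \<Longrightarrow> T_meld \<langle>t, a, u\<rangle> y = 1 + T_meld u y"
| "\<not> heap_min x \<le> Fin a \<Longrightarrow> T_meld x \<langle>t, a, u\<rangle> = 1 + T_meld x u"
  apply (atomize_elim, clarify)
  subgoal for x y by (cases x; cases y) auto
  by auto
termination by (relation "measure (\<lambda>(x, y). size x + size y)") auto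

text \<open>\<open>\<langle>\<rangle>\<close> is outside the domain of \<open>delmin\<close>, so neither it nor its cost is specified there.\<close>

fun delmin :: "'a::linorder tree \<Rightarrow> 'a tree" where
  "delmin \<langle>t, a, u\<rangle> = t \<oplus> u"

fun T_delmin :: "'a::linorder tree \<Rightarrow> nat" where
  "T_delmin \<langle>t, a, u\<rangle> = T_meld t u"

datatype 'a operation =
    Op_empty
  | Op_isEmpty "'a tree"
  | Op_single 'a
  | Op_min "'a tree"
  | Op_union "'a tree" "'a tree"
  | Op_delmin "'a tree"

fun actual_cost :: "'a::linorder operation \<Rightarrow> nat" where
  "actual_cost Op_empty = 0"
| "actual_cost (Op_isEmpty x) = 0"
| "actual_cost (Op_single a) = 0"
| "actual_cost (Op_min x) = 0"
| "actual_cost (Op_union x y) = T_meld x y"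
| "actual_cost (Op_delmin x) = T_delmin x"

fun heaps_before :: "'a::linorder operation \<Rightarrow> 'a tree list" where
  "heaps_before Op_empty = []"
| "heaps_before (Op_isEmpty x) = [x]"
| "heaps_before (Op_single a) = []"
| "heaps_before (Op_min x) = [x]"
| "heaps_before (Op_union x y) = [x, y]"
| "heaps_before (Op_delmin x) = [x]"

text \<open>
  The queries \<open>isEmpty\<close> and \<open>min\<close> return no heap but leave their argument
  in place, so its potential is still there afterwards.
\<close>

fun heaps_after :: "'a::linorder operation \<Rightarrow> 'a tree list" where
  "heaps_after Op_empty = [\<langle>\<rangle>]"
| "heaps_after (Op_isEmpty x) = [x]"
| "heaps_after (Op_single a) = [single a]"
| "heaps_after (Op_min x) = [x]"
| "heaps_after (Op_union x y) = [x \<oplus> y]"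
| "heaps_after (Op_delmin x) = [delmin x]"

definition amortized_cost :: "('a::linorder tree \<Rightarrow> real) \<Rightarrow> 'a operation \<Rightarrow> real" where
  "amortized_cost \<Phi> opn =
     real (actual_cost opn) + (\<Sum>x\<leftarrow>heaps_after opn. \<Phi> x) - (\<Sum>x\<leftarrow>heaps_before opn. \<Phi> x)"

definition potential_function :: "('a::linorder tree \<Rightarrow> real) \<Rightarrow> bool" where
  "potential_function \<Phi> \<longleftrightarrow> \<Phi> \<langle>\<rangle> = 0 \<and> (\<forall>x. wbl_heap x \<longrightarrow> \<Phi> x \<ge> 0)"

definition golden_ratio :: real where
  "golden_ratio = (sqrt 5 + 1) / 2"

end

theory Submission
  imports Defs
begin

text \<open>
  Let \<open>p = 1 / \<surd>5\<close> and \<open>q = (1 - p) / 2\<close>. A node \<open>\<langle>t, a, u\<rangle>\<close> contributes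
  \<open>p log\<^sub>\<phi> ((|t| + |u|) / |t|)\<close> to the potential, and melding \<open>x\<close> and \<open>y\<close> is charged
  \<open>p log\<^sub>\<phi> (|x| + |y| - 1) + q (log\<^sub>\<phi> |x| + log\<^sub>\<phi> |y|)\<close> up to a constant. As \<open>p + 2 q = 1\<close> and
  \<open>4 |x| |y| \<le> (|x| + |y|)\<^sup>2\<close>, this is at most \<open>log\<^sub>\<phi> (|x| + |y|)\<close>. In each unfolding step of
  \<open>\<oplus>\<close> the unit cost is paid for by
  \<open>1 \<le> p log\<^sub>\<phi> ((|t| + |u|) / |t|) + q log\<^sub>\<phi> ((|t| + |u|) / |u|)\<close>,
  and these values of \<open>p\<close> and \<open>q\<close> make \<open>\<phi>\<close> the largest base for which this holds. A singleton
  must have potential 0, so this step fails for it; the loss is covered since melding with the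
  empty heap only walks down a right spine.
\<close>

section \<open>Constants, and the inequality that pays for one comparison\<close>

abbreviation log_phi :: "real \<Rightarrow> real" where
  "log_phi \<equiv> log golden_ratio"

definition wt_p :: real where "wt_p = 1 / sqrt 5"
definition wt_q :: real where "wt_q = (1 - wt_p) / 2"

lemma wt_sum: "wt_p + 2 * wt_q = 1"
  by (simp add: wt_q_def field_simps)

lemma wt_p_pos: "0 < wt_p"
  by (simp add: wt_p_def)

lemma wt_p_less: "wt_p < 1 / 2"
proof -
  have "2 < sqrt (5::real)" by (rule real_less_rsqrt) simp
  then show ?thesis by (simp add: wt_p_def field_simps)
qed

lemma wt_q_pos: "0 < wt_q"
  using wt_p_less by (simp add: wt_q_def)

lemma wt_p_le: "wt_p \<le> 2 * wt_q"
  using wt_p_less by (simp add: wt_q_def)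

lemma golden_ratio_gt_1: "1 < golden_ratio"
proof -
  have "1 < sqrt (5::real)" by (rule real_less_rsqrt) simp
  then show ?thesis by (simp add: golden_ratio_def)
qed

lemma wt_golden_ratio: "wt_p * golden_ratio = wt_p + wt_q"
  by (simp add: wt_p_def wt_q_def golden_ratio_def field_simps)

lemma wt_golden_ratio_square: "wt_q * golden_ratio\<^sup>2 = wt_p + wt_q"
proof -
  have "wt_q * golden_ratio = wt_p"
    by (simp add: wt_p_def wt_q_def golden_ratio_def field_simps)
  then have "wt_q * golden_ratio\<^sup>2 = wt_p * golden_ratio"
    by (simp add: power2_eq_square flip: mult.assoc)
  then show ?thesis by (simp add: wt_golden_ratio)
qed

text \<open>Apply \<open>ln z \<le> z - 1\<close> to the two fractions of \<open>s + u\<close>,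
  scaled by \<open>golden_ratio\<close> and its square. By \<open>wt_golden_ratio\<close> and
  \<open>wt_golden_ratio_square\<close> both slopes are \<open>wt_p + wt_q\<close>, so the bound is
  0 because the fractions sum to 1. Equality occurs at \<open>s / u = golden_ratio\<close>.\<close>

lemma unit_le_log_ratios:
  fixes s u :: real
  assumes "0 < s" "0 < u"
  shows "1 \<le> wt_p * log_phi ((s + u) / s) + wt_q * log_phi ((s + u) / u)"
proof -
  let ?g = golden_ratio and ?a = "s / (s + u)" and ?b = "u / (s + u)"
  have g: "0 < ?g" "0 < ln ?g" using golden_ratio_gt_1 by auto
  have ab: "0 < ?a" "0 < ?b" "?a + ?b = 1"
    using assms by (auto simp: add_divide_distrib[symmetric])
  have 1: "ln (?a * ?g) \<le> ?a * ?g - 1" and 2: "ln (?b * ?g\<^sup>2) \<le> ?b * ?g\<^sup>2 - 1"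
    using ab g by (intro ln_le_minus_one mult_pos_pos zero_less_power; simp)+
  have "wt_p * ln (?a * ?g) + wt_q * ln (?b * ?g\<^sup>2)
      \<le> wt_p * (?a * ?g - 1) + wt_q * (?b * ?g\<^sup>2 - 1)"
    using 1 2 wt_p_pos wt_q_pos by (intro add_mono mult_left_mono) auto
  also have "\<dots> = ?a * (wt_p * ?g) + ?b * (wt_q * ?g\<^sup>2) - (wt_p + wt_q)"
    by (simp only: algebra_simps)
  also have "\<dots> = (?a + ?b) * (wt_p + wt_q) - (wt_p + wt_q)"
    unfolding wt_golden_ratio wt_golden_ratio_square by (simp only: algebra_simps)
  also have "\<dots> = 0" by (simp only: ab) simp
  finally have "wt_p * ln (?a * ?g) + wt_q * ln (?b * ?g\<^sup>2) \<le> 0" .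
  moreover have a: "ln (?a * ?g) = ln ?g - ln ((s + u) / s)"
    using assms g by (simp add: ln_mult ln_div)
  moreover have b: "ln (?b * ?g\<^sup>2) = 2 * ln ?g - ln ((s + u) / u)"
    using assms g by (simp add: ln_mult ln_div ln_realpow)
  ultimately have "(wt_p + 2 * wt_q) * ln ?g
      \<le> wt_p * ln ((s + u) / s) + wt_q * ln ((s + u) / u)"
    unfolding a b by (simp only: algebra_simps)
  then have "ln ?g \<le> wt_p * ln ((s + u) / s) + wt_q * ln ((s + u) / u)"
    by (simp add: wt_sum)
  then show ?thesis
    using g by (simp add: log_def flip: add_divide_distrib)
qed

lemma unit_le_log_2: "1 \<le> (wt_p + wt_q) * log_phi 2"
  using unit_le_log_ratios[of 1 1] by (simp add: algebra_simps)

lemma log_phi_mono: "0 < x \<Longrightarrow> x \<le> y \<Longrightarrow> log_phi x \<le> log_phi y"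
  using golden_ratio_gt_1 by simp

lemma log_phi_mult: "0 < x \<Longrightarrow> 0 < y \<Longrightarrow> log_phi (x * y) = log_phi x + log_phi y"
  using golden_ratio_gt_1 by (simp add: log_mult)

lemma log_phi_divide: "0 < x \<Longrightarrow> 0 < y \<Longrightarrow> log_phi (x / y) = log_phi x - log_phi y"
  using golden_ratio_gt_1 by (simp add: log_divide)

lemma log_phi_nonneg: "1 \<le> x \<Longrightarrow> 0 \<le> log_phi x"
  using golden_ratio_gt_1 by simp

section \<open>The potential and its behaviour under balancing\<close>

definition node_pot :: "nat \<Rightarrow> nat \<Rightarrow> real" where
  "node_pot s u = (if s = 1 \<and> u = 1 then 0 else wt_p * log_phi ((real s + real u) / real s))"

fun pot :: "'a tree \<Rightarrow> real" where
  "pot \<langle>\<rangle> = 0"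
| "pot \<langle>t, a, u\<rangle> = pot t + pot u + node_pot (size1 t) (size1 u)"

lemma node_pot_le: "0 < s \<Longrightarrow> node_pot s u \<le> wt_p * log_phi ((real s + real u) / real s)"
  using wt_p_pos by (auto simp: node_pot_def intro!: mult_nonneg_nonneg log_phi_nonneg)

lemma node_pot_nonneg: "0 < s \<Longrightarrow> 0 \<le> node_pot s u"
  using wt_p_pos by (auto simp: node_pot_def intro!: mult_nonneg_nonneg log_phi_nonneg)

lemma pot_nonneg: "0 \<le> pot x"
  by (induction x) (auto intro!: add_nonneg_nonneg node_pot_nonneg)

text \<open>\<open>bal\<close> puts the heavier tree on the left, so the denominator of the new
  node's ratio is at least \<open>size1 v\<close>.\<close>

lemma pot_bal_le:
  "pot (bal t a v) \<le> pot t + pot v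
    + wt_p * (log_phi (real (size1 t) + real (size1 v)) - log_phi (real (size1 v)))"
proof (cases "size v < size t")
  case True
  have "node_pot (size1 t) (size1 v)
      \<le> wt_p * log_phi ((real (size1 t) + real (size1 v)) / real (size1 t))"
    by (rule node_pot_le) simp
  also have "\<dots> \<le> wt_p * log_phi ((real (size1 t) + real (size1 v)) / real (size1 v))"
    using True wt_p_pos
    by (intro mult_left_mono log_phi_mono divide_left_mono) (auto simp: size1_size)
  finally show ?thesis
    using True by (simp add: bal_def log_phi_divide add_pos_pos)
next
  case False
  then show ?thesis
    using node_pot_le[of "size1 v" "size1 t"]
    by (simp add: bal_def log_phi_divide add_pos_pos add.commute)
qed

lemma size_bal [simp]: "size (bal t a u) = size t + size u + 1"
  by (simp add: bal_def)

lemma size_meld [simp]: "size (x \<oplus> y) = size x + size y"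
  by (induction x y rule: meld.induct) simp_all

section \<open>Melding with the empty heap\<close>

definition am_meld :: "'a::linorder tree \<Rightarrow> 'a tree \<Rightarrow> real" where
  "am_meld x y = real (T_meld x y) + pot (x \<oplus> y) - pot x - pot y"

text \<open>A swap can only occur when all three sizes agree, and then it does not affect
  \<open>node_pot\<close>.\<close>

lemma pot_bal_same_size:
  assumes "size v = size u" "size u \<le> size t"
  shows "pot (bal t a v) = pot t + pot v + node_pot (size1 t) (size1 u)"
  using assms by (auto simp: bal_def size1_size)

text \<open>A right subtree has at most half of \<open>size1\<close>, and by
  \<open>unit_le_log_2\<close> one halving pays for one comparison.\<close>

lemma log_phi_right_subtree:
  assumes "size u \<le> size t"
  shows "1 + (wt_p + wt_q) * log_phi (real (size1 u))
    \<le> (wt_p + wt_q) * log_phi (real (size1 t) + real (size1 u))"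
proof -
  have "log_phi 2 + log_phi (real (size1 u)) = log_phi (2 * real (size1 u))"
    by (simp add: log_phi_mult)
  also have "\<dots> \<le> log_phi (real (size1 t) + real (size1 u))"
    using assms by (intro log_phi_mono) (auto simp: size1_size)
  finally have "(wt_p + wt_q) * (log_phi 2 + log_phi (real (size1 u)))
      \<le> (wt_p + wt_q) * log_phi (real (size1 t) + real (size1 u))"
    using wt_p_pos wt_q_pos by (intro mult_left_mono) auto
  then show ?thesis using unit_le_log_2 by (simp add: algebra_simps)
qed

text \<open>The potential does not change, so only the right spine counts. This beats
  \<open>meld_bound\<close> with one argument 1 by \<open>2 * wt_q * log_phi 2\<close>, the reserve
  that singletons draw on in \<open>meld_step\<close>.\<close>

lemma am_meld_Leaf:
  assumes "weight_biased y"
  shows am_meld_Leaf_left: "am_meld \<langle>\<rangle> y \<le> (wt_p + wt_q) * log_phi (real (size1 y))"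
    and am_meld_Leaf_right: "am_meld y \<langle>\<rangle> \<le> (wt_p + wt_q) * log_phi (real (size1 y))"
proof -
  have "am_meld \<langle>\<rangle> y \<le> (wt_p + wt_q) * log_phi (real (size1 y))
    \<and> am_meld y \<langle>\<rangle> \<le> (wt_p + wt_q) * log_phi (real (size1 y))"
    using assms
  proof (induction y)
    case Leaf
    show ?case by (simp add: am_meld_def)
  next
    case (Node t a u)
    then show ?case
      using log_phi_right_subtree[of u t]
        pot_bal_same_size[of "\<langle>\<rangle> \<oplus> u" u t a] pot_bal_same_size[of "u \<oplus> \<langle>\<rangle>" u t a]
      by (auto simp: am_meld_def)
  qed
  then show "am_meld \<langle>\<rangle> y \<le> (wt_p + wt_q) * log_phi (real (size1 y))"
    and "am_meld y \<langle>\<rangle> \<le> (wt_p + wt_q) * log_phi (real (size1 y))"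
    by blast+
qed

section \<open>Melding two arbitrary heaps\<close>

text \<open>The \<open>-1\<close> makes the argument of the first logarithm equal to \<open>|x \<oplus> y|\<close>.\<close>

definition meld_bound :: "nat \<Rightarrow> nat \<Rightarrow> real" where
  "meld_bound m n = wt_p * log_phi (real m + real n - 1)
     + wt_q * (log_phi (real m) + log_phi (real n)) + 2 * wt_q * log_phi 2"

lemma meld_bound_commute: "meld_bound m n = meld_bound n m"
  by (simp add: meld_bound_def add.commute)

text \<open>The constant term of \<open>meld_bound\<close> supplies the factor 4 in
  \<open>4 * m * n \<le> (m + n)\<^sup>2\<close>.\<close>

lemma meld_bound_le:
  assumes "0 < m" "0 < n"
  shows "meld_bound m n \<le> log_phi (real (m + n))"
proof -
  let ?L = "log_phi (real m + real n)"
  have "log_phi (2 * 2) = 2 * log_phi 2"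
    by (subst log_phi_mult) simp_all
  then have "2 * log_phi 2 + (log_phi (real m) + log_phi (real n)) = log_phi ((2 * 2) * (real m * real n))"
    using assms by (simp add: log_phi_mult del: num_double)
  also have "\<dots> \<le> log_phi ((real m + real n) * (real m + real n))"
  proof (rule log_phi_mono)
    show "0 < 2 * 2 * (real m * real n)" using assms by simp
    have "0 \<le> (real m - real n)\<^sup>2" by simp
    then show "2 * 2 * (real m * real n) \<le> (real m + real n) * (real m + real n)"
      by (simp add: power2_eq_square algebra_simps)
  qed
  also have "\<dots> = 2 * ?L"
    using assms by (simp add: log_phi_mult)
  finally have "wt_q * (2 * log_phi 2 + (log_phi (real m) + log_phi (real n))) \<le> wt_q * (2 * ?L)"
    using wt_q_pos by (intro mult_left_mono) auto
  moreover have "wt_p * log_phi (real m + real n - 1) \<le> wt_p * ?L"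
    using assms wt_p_pos by (intro mult_left_mono log_phi_mono) auto
  ultimately have "meld_bound m n \<le> (wt_p + 2 * wt_q) * ?L"
    by (simp add: meld_bound_def algebra_simps)
  then show ?thesis by (simp add: wt_sum)
qed

text \<open>
  The common step of both recursive equations of \<open>\<oplus>\<close>: here \<open>v\<close> is \<open>u \<oplus> y\<close> or \<open>y \<oplus> u\<close>,
  and \<open>c\<close> is its amortized cost.
\<close>

lemma meld_step:
  assumes size: "size v = size u + size y"
    and biased: "size u \<le> size t"
    and c: "c \<le> meld_bound (size1 u) (size1 y)"
    and c_Leaf: "u = \<langle>\<rangle> \<Longrightarrow> c \<le> (wt_p + wt_q) * log_phi (real (size1 y))"
  shows "1 + c + pot (bal t a v) - pot v - pot t - node_pot (size1 t) (size1 u)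
    \<le> meld_bound (size1 \<langle>t, a, u\<rangle>) (size1 y)"
proof -
  let ?s = "real (size1 t)" and ?u = "real (size1 u)" and ?y = "real (size1 y)"
    and ?r = "real (size1 v)"
  have r: "?u + ?y - 1 = ?r" "?s + ?u + ?y - 1 = ?s + ?r"
    using size by (simp_all add: size1_size)
  have bound: "meld_bound (size1 \<langle>t, a, u\<rangle>) (size1 y)
      = wt_p * log_phi (?s + ?r) + wt_q * (log_phi (?s + ?u) + log_phi ?y) + 2 * wt_q * log_phi 2"
    unfolding meld_bound_def by (simp flip: r(2))
  show ?thesis
  proof (cases "size t = 0")
    case True
    then have [simp]: "t = \<langle>\<rangle>" "u = \<langle>\<rangle>" using biased by auto
    have "?r = ?y" using r by simp
    \<comment> \<open>Two of the three summands are the reserve from \<open>c_Leaf\<close>; the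
      third comes from the melded node having \<open>size1\<close> equal to 2.\<close>
    moreover have "1 \<le> 3 * wt_q * log_phi 2"
    proof -
      have "(wt_p + wt_q) * log_phi 2 \<le> 3 * wt_q * log_phi 2"
        using wt_p_le by (intro mult_right_mono log_phi_nonneg) auto
      then show ?thesis using unit_le_log_2 by simp
    qed
    ultimately show ?thesis
      using c_Leaf pot_bal_le[of t a v] unfolding bound
      by (simp add: node_pot_def algebra_simps)
  next
    case False
    \<comment> \<open>The first summand is the potential released by the old node, the second the
      growth of the \<open>wt_q\<close> term from \<open>u\<close> to the whole tree. The terms
      \<open>wt_p * log_phi ?r\<close> cancel.\<close>
    have "1 \<le> wt_p * log_phi ((?s + ?u) / ?s) + wt_q * log_phi ((?s + ?u) / ?u)"
      by (rule unit_le_log_ratios) simp_all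
    moreover have "node_pot (size1 t) (size1 u) = wt_p * log_phi ((?s + ?u) / ?s)"
      using False by (simp add: node_pot_def size1_size)
    moreover have "log_phi ((?s + ?u) / ?u) = log_phi (?s + ?u) - log_phi ?u"
      by (simp add: log_phi_divide add_pos_pos)
    ultimately show ?thesis
      using c pot_bal_le[of t a v] unfolding bound unfolding meld_bound_def r(1)
      by (simp add: algebra_simps)
  qed
qed

lemma am_meld_le_meld_bound:
  assumes "weight_biased x" "weight_biased y"
  shows "am_meld x y \<le> meld_bound (size1 x) (size1 y)"
  using assms
proof (induction x y rule: meld.induct)
  case 1
  show ?case
    using wt_q_pos by (simp add: am_meld_def meld_bound_def log_phi_nonneg)
next
  case (2 a y t u)
  have "1 + am_meld u y + pot (bal t a (u \<oplus> y)) - pot (u \<oplus> y) - pot t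
      - node_pot (size1 t) (size1 u) \<le> meld_bound (size1 \<langle>t, a, u\<rangle>) (size1 y)"
    using 2 am_meld_Leaf_left[of y] by (intro meld_step) auto
  then show ?case using 2(1) by (simp add: am_meld_def)
next
  case (3 x a t u)
  have "1 + am_meld x u + pot (bal t a (x \<oplus> u)) - pot (x \<oplus> u) - pot t
      - node_pot (size1 t) (size1 u) \<le> meld_bound (size1 \<langle>t, a, u\<rangle>) (size1 x)"
    using 3 am_meld_Leaf_right[of x] by (intro meld_step) (auto simp: meld_bound_commute)
  then show ?case
    using 3(1) by (simp add: am_meld_def meld_bound_commute[of "size1 x"])
qed

lemma am_meld_le:
  assumes "weight_biased x" "weight_biased y"
  shows "am_meld x y \<le> log_phi (real (size1 x + size1 y))"
  using am_meld_le_meld_bound[OF assms] meld_bound_le[of "size1 x" "size1 y"] by simp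

theorem theorem1:
  shows "\<exists>\<Phi> :: 'a::linorder tree \<Rightarrow> real. potential_function \<Phi> \<and>
    amortized_cost \<Phi> Op_empty = 0 \<and>
    (\<forall>x. wbl_heap x \<longrightarrow> amortized_cost \<Phi> (Op_isEmpty x) = 0) \<and>
    (\<forall>a. amortized_cost \<Phi> (Op_single a) = 0) \<and>
    (\<forall>x. wbl_heap x \<longrightarrow> amortized_cost \<Phi> (Op_min x) = 0) \<and>
    (\<forall>x y. wbl_heap x \<longrightarrow> wbl_heap y \<longrightarrow>
      amortized_cost \<Phi> (Op_union x y) \<le> log golden_ratio (real (size1 x + size1 y))) \<and>
    (\<forall>x. wbl_heap x \<longrightarrow> x \<noteq> \<langle>\<rangle> \<longrightarrow>
      amortized_cost \<Phi> (Op_delmin x) \<le> log golden_ratio (real (size1 x)))"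
proof (intro exI conjI allI impI)
  let ?\<Phi> = "pot :: 'a tree \<Rightarrow> real"
  show "potential_function ?\<Phi>"
    by (simp add: potential_function_def pot_nonneg)
  show "amortized_cost ?\<Phi> Op_empty = 0"
    by (simp add: amortized_cost_def)
  show "amortized_cost ?\<Phi> (Op_isEmpty x) = 0" for x
    by (simp add: amortized_cost_def)
  show "amortized_cost ?\<Phi> (Op_single a) = 0" for a
    by (simp add: amortized_cost_def single_def node_pot_def)
  show "amortized_cost ?\<Phi> (Op_min x) = 0" for x
    by (simp add: amortized_cost_def)
  show "amortized_cost ?\<Phi> (Op_union x y) \<le> log_phi (real (size1 x + size1 y))"
    if "wbl_heap x" "wbl_heap y" for x y
    using that am_meld_le[of x y] by (simp add: amortized_cost_def am_meld_def wbl_heap_def)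
  show "amortized_cost ?\<Phi> (Op_delmin x) \<le> log_phi (real (size1 x))"
    if heap: "wbl_heap x" and nonempty: "x \<noteq> \<langle>\<rangle>" for x
  proof -
    obtain t a u where x: "x = \<langle>t, a, u\<rangle>" using nonempty by (cases x) auto
    \<comment> \<open>\<open>size1 x\<close> is exactly \<open>size1 t + size1 u\<close>, and the
      potential released by the root can only lower the cost.\<close>
    then show ?thesis
      using heap am_meld_le[of t u] node_pot_nonneg[of "size1 t" "size1 u"]
      by (simp add: amortized_cost_def am_meld_def wbl_heap_def)
  qed
qed

end
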